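(* Let $r\ge0$ and let $f,g:A\to B$ be morphisms of derived $A_\infty$-algebras. Giving an $r$-homotopy $h:A\to P_r(B)$ from $f$ to $g$ is equivalent to giving a collection of morphisms $h_{ik}:A^{\otimes k}\to B$, $i\ge0$, $k\ge1$, of bidegree $(r-i,r-i-k)$, satisfying for all $m\ge0$ and $k\ge1$ $$(-1)^{m-r}\sum_{i+p=m}\Bigl(\sum_l m^B_{il}\sum_{\substack{0\le s\le l-1\\ p_1+\cdots+p_l=p\\ q_1+\cdots+q_l=k}}(-1)^{p+\alpha+\sum_{u=1}^sp_u}\,g_{p_1q_1}\otimes\cdots\otimes g_{p_sq_s}\otimes h_{p_{s+1}q_{s+1}}\otimes f_{p_{s+2}q_{s+2}}\otimes\cdots\otimes f_{p_lq_l}$$ $$\qquad+\sum_l h_{il}\sum_{\substack{q+s+t=k\\ s+1+t=l}}(-1)^{\beta}\,1^{\otimes s}\otimes m_{pq}^A\otimes1^{\otimes t}\Bigr)=\begin{cases}0&\text{if }m<r,\\ g_{m-r,k}-f_{m-r,k}&\text{if }m\ge r,\end{cases}$$ where $$\alpha=\sum_{u=1}^l(p_u+q_u)(l+u)+\sum_{u=1}^lq_u\Bigl(\sum_{v=u+1}^l(p_v+q_v)\Bigr)+(r-1)\Bigl(l+1+s+\sum_{u=1}^sq_u\Bigr),\qquad\beta=sq+t+pl+r.$$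
   Context: $R$ is a commutative ring with unit. Bigraded modules $A=\{A_i^j\}$ are $(\mathbb Z,\mathbb Z)$-bigraded $R$-modules; a map of bidegree $(p,q)$ sends $A_i^j$ to $A_{i+p}^{j+q}$; $\langle(x_1,x_2),(y_1,y_2)\rangle=x_1y_1+x_2y_2$; Koszul rule $(f\otimes g)(a\otimes c)=(-1)^{\langle g,a\rangle}f(a)\otimes g(c)$. Derived $A_\infty$-algebras: bigraded modules $A$ with maps $m_{ij}:A^{\otimes j}\to A$, $i\ge0,j\ge1$, of bidegree $(-i,2-i-j)$ such that for all $u\ge0,v\ge1$, $\sum_{u=i+p,\ v=j+q-1,\ j=1+s+t}(-1)^{sq+t+pj}m_{ij}(1^{\otimes s}\otimes m_{pq}\otimes1^{\otimes t})=0$. Morphisms $f:A\to B$: families $f_{ij}:A^{\otimes j}\to B$, $i\ge0,j\ge1$, of bidegree $(-i,1-i-j)$ with, for all $u\ge0,v\ge1$, $$\sum_{u=i+p,\ v=j+q-1,\ j=1+s+t}(-1)^{sq+t+pj}f_{ij}(1^{\otimes s}\otimes m^A_{pq}\otimes1^{\otimes t})=\sum_{u=i+p_1+\cdots+p_j,\ v=q_1+\cdots+q_j}(-1)^{\sigma}m^B_{ij}(f_{p_1q_1}\otimes\cdots\otimes f_{p_jq_j}),$$ $\sigma=u+\sum_{t=1}^j\bigl((p_t+q_t)(j+t)+q_t\sum_{w=t+1}^j(p_w+q_w)\bigr)$. The $r$-path $P_r(B)$ of $(B,m_{ij})$ is the derived $A_\infty$-algebra $P_r(B)_i^j=B_i^j\oplus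 B_{i+r}^{j+r-1}\oplus B_i^j$ with $M_{r1}(x,y,z)=(m_{r1}x,-x-m_{r1}y+z,m_{r1}z)$, $M_{i1}(x,y,z)=(m_{i1}x,(-1)^{i+r+1}m_{i1}y,m_{i1}z)$ for $i\ne r$, and for $j\ge2$, $M_{ij}=\mathrm{diag}(m_{ij},(-1)^{rj+i+j}m_{ij},m_{ij})\circ t_j$, where $t_n:P_r(B)^{\otimes n}\to P_r(B^{\otimes n})$ is $$t_n\bigl(\textstyle\bigotimes_k(x_k,y_k,z_k)\bigr)=\bigl(x_1\otimes\cdots\otimes x_n,\ \sum_{1\le j\le n}\overline x_1\otimes\cdots\otimes\overline x_{j-1}\otimes y_j\otimes z_{j+1}\otimes\cdots\otimes z_n,\ z_1\otimes\cdots\otimes z_n\bigr),$$ $\overline x=(-1)^{rx_1+(1-r)x_2}x$ for $x$ of bidegree $(x_1,x_2)$. An $r$-homotopy from $f$ to $g$ is a morphism of derived $A_\infty$-algebras $h:A\to P_r(B)$ with $\partial^-\circ h=f$ and $\partial^+\circ h=g$ (componentwise, $\partial^-$ and $\partial^+$ applied to the $(i,j)$ component of $h$ give $f_{ij}$ and $g_{ij}$), where $\partial^-(x,y,z)=x$, $\partial^+(x,y,z)=z$.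
   Formalization: In the first sum the tensor factors are taken as f⊗…⊗f⊗h⊗g⊗…⊗g (s copies of f on the left, g on the right) instead of the printed g⊗…⊗g⊗h⊗f⊗…⊗f, since the printed order is false for the given P_r(B), t_n, ∂^- and ∂^+. *)

theory Defs
  imports Complex_Main "HOL-Library.Product_Plus"
begin

section \<open>Bigraded modules and multilinear maps\<close>

type_synonym bideg = "int \<times> int"

text \<open>
  A bigraded module is a family \<open>A :: bideg \<Rightarrow> 'a set\<close> of submodules of an ambient
  module with scalar multiplication \<open>sc\<close>. The element \<open>x \<in> A d\<close> is represented by the pair \<open>(d, x)\<close>;
  no directness of the family is needed, because all maps take the bidegree as input.
\<close>

type_synonym 'a helt = "bideg \<times> 'a"

definition bigraded_module ::
  "('r::comm_ring_1 \<Rightarrow> 'a::ab_group_add \<Rightarrow> 'a) \<Rightarrow> (bideg \<Rightarrow> 'a set) \<Rightarrow> bool" where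
  "bigraded_module sc A \<longleftrightarrow> module sc \<and> (\<forall>d. module.subspace sc (A d))"

definition homog :: "(bideg \<Rightarrow> 'a set) \<Rightarrow> 'a helt list \<Rightarrow> bool" where
  "homog A xs \<longleftrightarrow> (\<forall>(d, x) \<in> set xs. x \<in> A d)"

definition hdeg :: "'a helt list \<Rightarrow> bideg" where
  "hdeg xs = sum_list (map fst xs)"

text \<open>
  An \<open>R\<close>-linear map \<open>A\<^sup>\<otimes>\<^sup>n \<rightarrow> B\<close> of bidegree \<open>\<delta>\<close>, given through the universal property of the tensor
  power as a family of \<open>R\<close>-multilinear maps \<open>A d\<^sub>1 \<times> \<dots> \<times> A d\<^sub>n \<rightarrow> B (d\<^sub>1 + \<dots> + d\<^sub>n + \<delta>)\<close>.
  Off its domain \<open>F\<close> is required to vanish, so that equal maps are equal as HOL functions.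
\<close>

definition multilinear_map ::
  "('r::comm_ring_1 \<Rightarrow> 'a::ab_group_add \<Rightarrow> 'a) \<Rightarrow> (bideg \<Rightarrow> 'a set) \<Rightarrow>
   ('r \<Rightarrow> 'b::ab_group_add \<Rightarrow> 'b) \<Rightarrow> (bideg \<Rightarrow> 'b set) \<Rightarrow>
   nat \<Rightarrow> bideg \<Rightarrow> ('a helt list \<Rightarrow> 'b) \<Rightarrow> bool" where
  "multilinear_map scA A scB B n \<delta> F \<longleftrightarrow>
     (\<forall>xs. length xs = n \<and> homog A xs \<longrightarrow> F xs \<in> B (hdeg xs + \<delta>)) \<and>
     (\<forall>us vs d x y. length us + 1 + length vs = n \<and> homog A us \<and> homog A vs \<and> x \<in> A d \<and> y \<in> A d \<longrightarrow>
        F (us @ (d, x + y) # vs) = F (us @ (d, x) # vs) + F (us @ (d, y) # vs)) \<and>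
     (\<forall>us vs d c x. length us + 1 + length vs = n \<and> homog A us \<and> homog A vs \<and> x \<in> A d \<longrightarrow>
        F (us @ (d, scA c x) # vs) = scB c (F (us @ (d, x) # vs))) \<and>
     (\<forall>xs. \<not> (length xs = n \<and> homog A xs) \<longrightarrow> F xs = 0)"

text \<open>
  Families \<open>F\<^sub>i\<^sub>j : A\<^sup>\<otimes>\<^sup>j \<rightarrow> B\<close> with \<open>i \<ge> 0\<close>, \<open>j \<ge> 1\<close>, where \<open>F\<^sub>i\<^sub>j\<close> has bidegree \<open>\<delta> i j\<close>. The unused
  entries \<open>F i 0\<close> are set to zero.
\<close>

definition graded_family ::
  "('r::comm_ring_1 \<Rightarrow> 'a::ab_group_add \<Rightarrow> 'a) \<Rightarrow> (bideg \<Rightarrow> 'a set) \<Rightarrow>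
   ('r \<Rightarrow> 'b::ab_group_add \<Rightarrow> 'b) \<Rightarrow> (bideg \<Rightarrow> 'b set) \<Rightarrow>
   (nat \<Rightarrow> nat \<Rightarrow> bideg) \<Rightarrow> (nat \<Rightarrow> nat \<Rightarrow> 'a helt list \<Rightarrow> 'b) \<Rightarrow> bool" where
  "graded_family scA A scB B \<delta> F \<longleftrightarrow>
     (\<forall>i. \<forall>j\<ge>1. multilinear_map scA A scB B j (\<delta> i j) (F i j)) \<and> (\<forall>i. F i 0 = (\<lambda>_. 0))"


section \<open>Signs and tensor products of maps\<close>

text \<open>\<open>sgn_pow e x\<close> is \<open>(-1)\<^sup>e x\<close>; the exponent \<open>e\<close> may be negative.\<close>

definition sgn_pow :: "int \<Rightarrow> 'a::ab_group_add \<Rightarrow> 'a" where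
  "sgn_pow e x = (if even e then x else - x)"

definition bipair :: "bideg \<Rightarrow> bideg \<Rightarrow> int" where
  "bipair x y = fst x * fst y + snd x * snd y"

text \<open>A triple \<open>(\<delta>, n, F)\<close> stands for a map \<open>F : A\<^sup>\<otimes>\<^sup>n \<rightarrow> B\<close> of bidegree \<open>\<delta>\<close>.\<close>

type_synonym ('a, 'b) gmap = "bideg \<times> nat \<times> ('a helt list \<Rightarrow> 'b)"

definition id_map :: "('a, 'a) gmap" where
  "id_map = ((0, 0), 1, \<lambda>xs. snd (hd xs))"

text \<open>
  The value of \<open>\<phi>\<^sub>1 \<otimes> \<dots> \<otimes> \<phi>\<^sub>l\<close> on \<open>a\<^sub>1 \<otimes> \<dots> \<otimes> a\<^sub>n\<close> is the decomposable tensor listed by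
  \<open>tensor_args\<close>, times the sign with exponent \<open>tensor_sign\<close>. The latter applies the Koszul rule to
  \<open>\<phi>\<^sub>1 \<otimes> (\<phi>\<^sub>2 \<otimes> \<dots> \<otimes> \<phi>\<^sub>l)\<close> recursively.
\<close>

fun tensor_args :: "('a, 'b) gmap list \<Rightarrow> 'a helt list \<Rightarrow> 'b helt list" where
  "tensor_args [] xs = []"
| "tensor_args ((\<delta>, n, F) # \<phi>s) xs =
     (hdeg (take n xs) + \<delta>, F (take n xs)) # tensor_args \<phi>s (drop n xs)"

fun tensor_sign :: "('a, 'b) gmap list \<Rightarrow> 'a helt list \<Rightarrow> int" where
  "tensor_sign [] xs = 0"
| "tensor_sign ((\<delta>, n, F) # \<phi>s) xs =
     bipair (sum_list (map fst \<phi>s)) (hdeg (take n xs)) + tensor_sign \<phi>s (drop n xs)"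

text \<open>\<open>G \<circ> (\<phi>\<^sub>1 \<otimes> \<dots> \<otimes> \<phi>\<^sub>l)\<close>, for linear \<open>G\<close>.\<close>

definition comp_tensor ::
  "('b helt list \<Rightarrow> 'c::ab_group_add) \<Rightarrow> ('a, 'b) gmap list \<Rightarrow> 'a helt list \<Rightarrow> 'c" where
  "comp_tensor G \<phi>s xs = sgn_pow (tensor_sign \<phi>s xs) (G (tensor_args \<phi>s xs))"


section \<open>Derived A-infinity algebras and their morphisms\<close>

definition alg_deg :: "nat \<Rightarrow> nat \<Rightarrow> bideg" where
  "alg_deg i j = (- int i, 2 - int i - int j)"

definition mor_deg :: "nat \<Rightarrow> nat \<Rightarrow> bideg" where
  "mor_deg i j = (- int i, 1 - int i - int j)"

definition insert_op ::
  "(nat \<Rightarrow> nat \<Rightarrow> 'a helt list \<Rightarrow> 'a) \<Rightarrow> nat \<Rightarrow> nat \<Rightarrow> nat \<Rightarrow> nat \<Rightarrow> ('a, 'a) gmap list" where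
  "insert_op m s p q t = replicate s id_map @ [(alg_deg p q, q, m p q)] @ replicate t id_map"

definition insert_indices :: "nat \<Rightarrow> nat \<Rightarrow> (nat \<times> nat \<times> nat \<times> nat \<times> nat \<times> nat) set" where
  "insert_indices u v =
     {(i, j, p, q, s, t). u = i + p \<and> q \<ge> 1 \<and> v + 1 = j + q \<and> j = 1 + s + t}"

definition dA_algebra ::
  "('r::comm_ring_1 \<Rightarrow> 'a::ab_group_add \<Rightarrow> 'a) \<Rightarrow> (bideg \<Rightarrow> 'a set) \<Rightarrow>
   (nat \<Rightarrow> nat \<Rightarrow> 'a helt list \<Rightarrow> 'a) \<Rightarrow> bool" where
  "dA_algebra sc A m \<longleftrightarrow>
     bigraded_module sc A \<and> graded_family sc A sc A alg_deg m \<and>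
     (\<forall>u. \<forall>v\<ge>1. \<forall>xs. length xs = v \<and> homog A xs \<longrightarrow>
        (\<Sum>(i, j, p, q, s, t) \<in> insert_indices u v.
           sgn_pow (int (s * q + t + p * j)) (comp_tensor (m i j) (insert_op m s p q t) xs)) = 0)"

text \<open>The lists \<open>ps\<close>, \<open>qs\<close> hold \<open>p\<^sub>1, \<dots>, p\<^sub>j\<close> and \<open>q\<^sub>1, \<dots>, q\<^sub>j\<close>; their common length is \<open>j\<close>.\<close>

definition block_indices :: "nat \<Rightarrow> nat \<Rightarrow> (nat list \<times> nat list) set" where
  "block_indices p k =
     {(ps, qs). length ps = length qs \<and> (\<forall>q \<in> set qs. q \<ge> 1) \<and> sum_list ps = p \<and> sum_list qs = k}"

definition block_sign :: "nat list \<Rightarrow> nat list \<Rightarrow> nat" where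
  "block_sign ps qs = (let j = length qs; p = (\<lambda>t. ps ! (t - 1)); q = (\<lambda>t. qs ! (t - 1)) in
     (\<Sum>t = 1..j. (p t + q t) * (j + t)) + (\<Sum>t = 1..j. q t * (\<Sum>w = t+1..j. p w + q w)))"

definition dA_morphism ::
  "('r::comm_ring_1 \<Rightarrow> 'a::ab_group_add \<Rightarrow> 'a) \<Rightarrow> (bideg \<Rightarrow> 'a set) \<Rightarrow>
   (nat \<Rightarrow> nat \<Rightarrow> 'a helt list \<Rightarrow> 'a) \<Rightarrow>
   ('r \<Rightarrow> 'b::ab_group_add \<Rightarrow> 'b) \<Rightarrow> (bideg \<Rightarrow> 'b set) \<Rightarrow>
   (nat \<Rightarrow> nat \<Rightarrow> 'b helt list \<Rightarrow> 'b) \<Rightarrow>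
   (nat \<Rightarrow> nat \<Rightarrow> 'a helt list \<Rightarrow> 'b) \<Rightarrow> bool" where
  "dA_morphism scA A mA scB B mB f \<longleftrightarrow>
     graded_family scA A scB B mor_deg f \<and>
     (\<forall>u. \<forall>v\<ge>1. \<forall>xs. length xs = v \<and> homog A xs \<longrightarrow>
        (\<Sum>(i, j, p, q, s, t) \<in> insert_indices u v.
           sgn_pow (int (s * q + t + p * j)) (comp_tensor (f i j) (insert_op mA s p q t) xs)) =
        (\<Sum>i\<le>u. \<Sum>(ps, qs) \<in> block_indices (u - i) v.
           sgn_pow (int (u + block_sign ps qs))
             (comp_tensor (mB i (length qs))
                (map (\<lambda>(p, q). (mor_deg p q, q, f p q)) (zip ps qs)) xs)))"


section \<open>The r-path and r-homotopies\<close>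

definition path_scale :: "('r \<Rightarrow> 'b \<Rightarrow> 'b) \<Rightarrow> 'r \<Rightarrow> 'b \<times> 'b \<times> 'b \<Rightarrow> 'b \<times> 'b \<times> 'b" where
  "path_scale sc c = (\<lambda>(x, y, z). (sc c x, sc c y, sc c z))"

definition path_shift :: "nat \<Rightarrow> bideg" where
  "path_shift r = (int r, int r - 1)"

definition path_carrier :: "nat \<Rightarrow> (bideg \<Rightarrow> 'b set) \<Rightarrow> bideg \<Rightarrow> ('b \<times> 'b \<times> 'b) set" where
  "path_carrier r B d = B d \<times> B (d + path_shift r) \<times> B d"

definition path_bar :: "nat \<Rightarrow> 'b::ab_group_add helt \<Rightarrow> 'b helt" where
  "path_bar r = (\<lambda>(d, x). (d, sgn_pow (int r * fst d + (1 - int r) * snd d) x))"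

definition path_xs :: "('b \<times> 'b \<times> 'b) helt list \<Rightarrow> 'b helt list" where
  "path_xs ws = map (\<lambda>(d, x, y, z). (d, x)) ws"

definition path_ys :: "nat \<Rightarrow> ('b \<times> 'b \<times> 'b) helt list \<Rightarrow> 'b helt list" where
  "path_ys r ws = map (\<lambda>(d, x, y, z). (d + path_shift r, y)) ws"

definition path_zs :: "('b \<times> 'b \<times> 'b) helt list \<Rightarrow> 'b helt list" where
  "path_zs ws = map (\<lambda>(d, x, y, z). (d, z)) ws"

text \<open>
  The middle component of \<open>t\<^sub>n\<close> is the sum, over \<open>k < n\<close>, of the decomposable tensors
  \<open>path_mid r ws k\<close>.
\<close>

definition path_mid ::
  "nat \<Rightarrow> ('b::ab_group_add \<times> 'b \<times> 'b) helt list \<Rightarrow> nat \<Rightarrow> 'b helt list" where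
  "path_mid r ws k =
     map (path_bar r) (take k (path_xs ws)) @ path_ys r ws ! k # drop (k + 1) (path_zs ws)"

definition path_op ::
  "nat \<Rightarrow> (bideg \<Rightarrow> 'b::ab_group_add set) \<Rightarrow> (nat \<Rightarrow> nat \<Rightarrow> 'b helt list \<Rightarrow> 'b) \<Rightarrow>
   nat \<Rightarrow> nat \<Rightarrow> ('b \<times> 'b \<times> 'b) helt list \<Rightarrow> 'b \<times> 'b \<times> 'b" where
  "path_op r B m i j ws =
     (if j \<ge> 1 \<and> length ws = j \<and> homog (path_carrier r B) ws then
        (m i j (path_xs ws),
         (if j = 1 \<and> i = r then
            - snd (hd (path_xs ws)) - m r 1 (path_ys r ws) + snd (hd (path_zs ws))
          else if j = 1 then
            sgn_pow (int (i + r + 1)) (m i 1 (path_ys r ws))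
          else
            sgn_pow (int (r * j + i + j)) (\<Sum>k<j. m i j (path_mid r ws k))),
         m i j (path_zs ws))
      else 0)"

definition path_minus :: "'b \<times> 'b \<times> 'b \<Rightarrow> 'b" where
  "path_minus = (\<lambda>(x, y, z). x)"

definition path_middle :: "'b \<times> 'b \<times> 'b \<Rightarrow> 'b" where
  "path_middle = (\<lambda>(x, y, z). y)"

definition path_plus :: "'b \<times> 'b \<times> 'b \<Rightarrow> 'b" where
  "path_plus = (\<lambda>(x, y, z). z)"

definition r_homotopy ::
  "nat \<Rightarrow> ('r::comm_ring_1 \<Rightarrow> 'a::ab_group_add \<Rightarrow> 'a) \<Rightarrow> (bideg \<Rightarrow> 'a set) \<Rightarrow>
   (nat \<Rightarrow> nat \<Rightarrow> 'a helt list \<Rightarrow> 'a) \<Rightarrow>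
   ('r \<Rightarrow> 'b::ab_group_add \<Rightarrow> 'b) \<Rightarrow> (bideg \<Rightarrow> 'b set) \<Rightarrow>
   (nat \<Rightarrow> nat \<Rightarrow> 'b helt list \<Rightarrow> 'b) \<Rightarrow>
   (nat \<Rightarrow> nat \<Rightarrow> 'a helt list \<Rightarrow> 'b) \<Rightarrow> (nat \<Rightarrow> nat \<Rightarrow> 'a helt list \<Rightarrow> 'b) \<Rightarrow>
   (nat \<Rightarrow> nat \<Rightarrow> 'a helt list \<Rightarrow> 'b \<times> 'b \<times> 'b) \<Rightarrow> bool" where
  "r_homotopy r scA A mA scB B mB f g h \<longleftrightarrow>
     dA_morphism scA A mA (path_scale scB) (path_carrier r B) (path_op r B mB) h \<and>
     (\<forall>i j. path_minus \<circ> h i j = f i j) \<and> (\<forall>i j. path_plus \<circ> h i j = g i j)"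


section \<open>Homotopies in terms of components\<close>

definition htp_deg :: "nat \<Rightarrow> nat \<Rightarrow> nat \<Rightarrow> bideg" where
  "htp_deg r i k = (int r - int i, int r - int i - int k)"

text \<open>
  The factors \<open>f\<^sub>p\<^sub>1\<^sub>q\<^sub>1, \<dots>, f\<^sub>p\<^sub>s\<^sub>q\<^sub>s, h\<^sub>p\<^sub>q, g\<^sub>p\<^sub>q, \<dots>\<close>, where \<open>h\<close> has position \<open>s + 1\<close>. The order is dictated by
  \<open>t\<^sub>n\<close>, which puts the components \<open>x\<close> (here \<open>f\<close>, by the condition on \<open>\<partial>\<^sup>-\<close>) to the left of \<open>y\<close> and the
  components \<open>z\<close> (here \<open>g\<close>) to its right. Beware of versions of the formula with \<open>f\<close> and \<open>g\<close>
  interchanged in these factors: they do not match \<open>t\<^sub>n\<close>, and the correspondence fails for them.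
\<close>

definition htp_factors ::
  "nat \<Rightarrow> (nat \<Rightarrow> nat \<Rightarrow> 'a helt list \<Rightarrow> 'b) \<Rightarrow> (nat \<Rightarrow> nat \<Rightarrow> 'a helt list \<Rightarrow> 'b) \<Rightarrow>
   (nat \<Rightarrow> nat \<Rightarrow> 'a helt list \<Rightarrow> 'b) \<Rightarrow> nat \<Rightarrow> nat list \<Rightarrow> nat list \<Rightarrow> ('a, 'b) gmap list" where
  "htp_factors r f h g s ps qs =
     (let pqs = zip ps qs in
       map (\<lambda>(p, q). (mor_deg p q, q, f p q)) (take s pqs) @
       map (\<lambda>(p, q). (htp_deg r p q, q, h p q)) [pqs ! s] @
       map (\<lambda>(p, q). (mor_deg p q, q, g p q)) (drop (s + 1) pqs))"

definition htp_alpha :: "nat \<Rightarrow> nat \<Rightarrow> nat list \<Rightarrow> nat list \<Rightarrow> int" where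
  "htp_alpha r s ps qs =
     int (block_sign ps qs) +
     (int r - 1) * (int (length qs) + 1 + int s + (\<Sum>u = 1..s. int (qs ! (u - 1))))"

definition htp_beta :: "nat \<Rightarrow> nat \<Rightarrow> nat \<Rightarrow> nat \<Rightarrow> nat \<Rightarrow> nat \<Rightarrow> int" where
  "htp_beta r p q s t l = int (s * q + t + p * l + r)"

definition htp_equation ::
  "nat \<Rightarrow> (nat \<Rightarrow> nat \<Rightarrow> 'a helt list \<Rightarrow> 'a) \<Rightarrow> (nat \<Rightarrow> nat \<Rightarrow> 'b::ab_group_add helt list \<Rightarrow> 'b) \<Rightarrow>
   (nat \<Rightarrow> nat \<Rightarrow> 'a helt list \<Rightarrow> 'b) \<Rightarrow> (nat \<Rightarrow> nat \<Rightarrow> 'a helt list \<Rightarrow> 'b) \<Rightarrow>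
   (nat \<Rightarrow> nat \<Rightarrow> 'a helt list \<Rightarrow> 'b) \<Rightarrow> nat \<Rightarrow> nat \<Rightarrow> 'a helt list \<Rightarrow> bool" where
  "htp_equation r mA mB f g h m k xs \<longleftrightarrow>
     sgn_pow (int m - int r)
       (\<Sum>(i, p) \<in> {(i, p). i + p = m}.
          (\<Sum>(ps, qs) \<in> block_indices p k. \<Sum>s \<in> {s. s < length qs}.
             sgn_pow (int p + htp_alpha r s ps qs + (\<Sum>u = 1..s. int (ps ! (u - 1))))
               (comp_tensor (mB i (length qs)) (htp_factors r f h g s ps qs) xs)) +
          (\<Sum>(l, q, s, t) \<in> {(l, q, s, t). q \<ge> 1 \<and> q + s + t = k \<and> s + 1 + t = l}.
             sgn_pow (htp_beta r p q s t l) (comp_tensor (h i l) (insert_op mA s p q t) xs)))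
     = (if m < r then 0 else g (m - r) k xs - f (m - r) k xs)"

definition htp_family ::
  "nat \<Rightarrow> ('r::comm_ring_1 \<Rightarrow> 'a::ab_group_add \<Rightarrow> 'a) \<Rightarrow> (bideg \<Rightarrow> 'a set) \<Rightarrow>
   (nat \<Rightarrow> nat \<Rightarrow> 'a helt list \<Rightarrow> 'a) \<Rightarrow>
   ('r \<Rightarrow> 'b::ab_group_add \<Rightarrow> 'b) \<Rightarrow> (bideg \<Rightarrow> 'b set) \<Rightarrow>
   (nat \<Rightarrow> nat \<Rightarrow> 'b helt list \<Rightarrow> 'b) \<Rightarrow>
   (nat \<Rightarrow> nat \<Rightarrow> 'a helt list \<Rightarrow> 'b) \<Rightarrow> (nat \<Rightarrow> nat \<Rightarrow> 'a helt list \<Rightarrow> 'b) \<Rightarrow>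
   (nat \<Rightarrow> nat \<Rightarrow> 'a helt list \<Rightarrow> 'b) \<Rightarrow> bool" where
  "htp_family r scA A mA scB B mB f g h \<longleftrightarrow>
     graded_family scA A scB B (htp_deg r) h \<and>
     (\<forall>m. \<forall>k\<ge>1. \<forall>xs. length xs = k \<and> homog A xs \<longrightarrow> htp_equation r mA mB f g h m k xs)"

end

theory Submission
  imports Defs
begin

text \<open>
  A map into the path object is a triple \<open>(f, h, g)\<close>. Its outer components satisfy the morphism
  equations because \<open>f\<close> and \<open>g\<close> do, so everything rests on the middle component: \<open>t\<^sub>l\<close> expands
  \<open>M\<^sub>i\<^sub>l\<close> into the sum over the position \<open>s + 1\<close> of \<open>h\<close>, while the terms \<open>-x + z\<close> of \<open>M\<^sub>r\<^sub>1\<close>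
  contribute \<open>g - f\<close>. Up to the global sign \<open>(-1)\<^sup>r\<close> this is the homotopy equation.
\<close>

section \<open>Signs (-1)^e and sums of triples\<close>

lemma sgn_pow_sgn_pow [simp]: "sgn_pow a (sgn_pow b x) = sgn_pow (a + b) x"
  by (simp add: sgn_pow_def)

lemma sgn_pow_commute: "sgn_pow a (sgn_pow b x) = sgn_pow b (sgn_pow a x)"
  by (simp add: add.commute)

lemma sgn_pow_zero [simp]: "sgn_pow e 0 = 0"
  by (simp add: sgn_pow_def)

lemma sgn_pow_add: "sgn_pow e (x + y) = sgn_pow e x + sgn_pow e y"
  by (simp add: sgn_pow_def)

lemma sgn_pow_sum: "sgn_pow e (\<Sum>i\<in>I. F i) = (\<Sum>i\<in>I. sgn_pow e (F i))"
  by (simp add: sgn_pow_def sum_negf)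

lemma sgn_pow_cong: "even (a - b) \<Longrightarrow> sgn_pow a x = sgn_pow b x"
  by (simp add: sgn_pow_def)

lemma sgn_pow_triple: "sgn_pow e (x, y, z) = (sgn_pow e x, sgn_pow e y, sgn_pow e z)"
  by (simp add: sgn_pow_def)

lemma sum_triple:
  "(\<Sum>i\<in>I. (F i, G i, H i)) = (\<Sum>i\<in>I. F i, \<Sum>i\<in>I. G i, \<Sum>i\<in>I. H i)"
  by (induction I rule: infinite_finite_induct) (auto simp: zero_prod_def)

section \<open>Bidegrees and Koszul signs of tensor products of maps\<close>

lemma hdeg_Nil [simp]: "hdeg [] = 0"
  and hdeg_Cons [simp]: "hdeg (x # xs) = fst x + hdeg xs"
  and hdeg_append [simp]: "hdeg (xs @ ys) = hdeg xs + hdeg ys"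
  by (simp_all add: hdeg_def)

lemma homog_Nil [simp]: "homog A []"
  and homog_Cons [simp]: "homog A (x # xs) \<longleftrightarrow> snd x \<in> A (fst x) \<and> homog A xs"
  and homog_append [simp]: "homog A (xs @ ys) \<longleftrightarrow> homog A xs \<and> homog A ys"
  by (auto simp: homog_def)

lemma homog_take: "homog A xs \<Longrightarrow> homog A (take n xs)"
  and homog_drop: "homog A xs \<Longrightarrow> homog A (drop n xs)"
  by (auto simp: homog_def dest: in_set_takeD in_set_dropD)

lemma bipair_add_left: "bipair (x + y) z = bipair x z + bipair y z"
  and bipair_add_right: "bipair x (y + z) = bipair x y + bipair x z"
  by (simp_all add: bipair_def algebra_simps)

lemma bipair_zero [simp]: "bipair 0 z = 0" "bipair z 0 = 0"
  by (simp_all add: bipair_def)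

abbreviation arity :: "('a, 'b) gmap list \<Rightarrow> nat" where
  "arity \<phi>s \<equiv> sum_list (map (fst \<circ> snd) \<phi>s)"

lemma tensor_args_append:
  "tensor_args (\<phi>s @ \<psi>s) xs = tensor_args \<phi>s xs @ tensor_args \<psi>s (drop (arity \<phi>s) xs)"
  by (induction \<phi>s xs rule: tensor_args.induct) (auto simp: add.commute)

text \<open>The middle summand is the cost of moving all of \<open>\<psi>s\<close> past the inputs
  consumed by \<open>\<phi>s\<close>. Biadditivity of \<open>bipair\<close> makes this an identity
  of integer exponents, not just of parities.\<close>

lemma tensor_sign_append:
  "tensor_sign (\<phi>s @ \<psi>s) xs =
     tensor_sign \<phi>s xs + bipair (sum_list (map fst \<psi>s)) (hdeg (take (arity \<phi>s) xs)) +
     tensor_sign \<psi>s (drop (arity \<phi>s) xs)"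
  by (induction \<phi>s xs rule: tensor_args.induct)
    (auto simp: add.commute take_add bipair_add_left bipair_add_right)

lemma length_tensor_args [simp]: "length (tensor_args \<phi>s xs) = length \<phi>s"
  by (induction \<phi>s xs rule: tensor_args.induct) auto

lemma hdeg_tensor_args:
  "hdeg (tensor_args \<phi>s xs) = hdeg (take (arity \<phi>s) xs) + sum_list (map fst \<phi>s)"
  by (induction \<phi>s xs rule: tensor_args.induct) (auto simp: take_add)

text \<open>A list of pairs replaces the two lists of \<open>block_indices\<close>, so that
  splitting a tensor product at the position of \<open>h\<close> is a list append. The bidegree is a
  parameter because \<open>h\<close> uses \<open>htp_deg\<close> while \<open>f\<close> and
  \<open>g\<close> use \<open>mor_deg\<close>.\<close>

definition factors ::
  "(nat \<Rightarrow> nat \<Rightarrow> bideg) \<Rightarrow> (nat \<Rightarrow> nat \<Rightarrow> 'a helt list \<Rightarrow> 'b) \<Rightarrow> (nat \<times> nat) list \<Rightarrow>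
   ('a, 'b) gmap list" where
  "factors \<delta> F = map (\<lambda>(p, q). (\<delta> p q, q, F p q))"

lemma factors_Nil [simp]: "factors \<delta> F [] = []"
  and factors_Cons [simp]: "factors \<delta> F (pq # pqs) =
    (\<delta> (fst pq) (snd pq), snd pq, F (fst pq) (snd pq)) # factors \<delta> F pqs"
  and factors_append [simp]: "factors \<delta> F (us @ vs) = factors \<delta> F us @ factors \<delta> F vs"
  and length_factors [simp]: "length (factors \<delta> F pqs) = length pqs"
  by (auto simp: factors_def split: prod.splits)

lemma arity_factors [simp]: "arity (factors \<delta> F pqs) = sum_list (map snd pqs)"
  by (induction pqs) auto

lemma sum_deg_factors:
  "sum_list (map fst (factors \<delta> F pqs)) = (\<Sum>(p, q)\<leftarrow>pqs. \<delta> p q)"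
  by (induction pqs) auto

lemma sum_mor_deg:
  "(\<Sum>(p, q)\<leftarrow>pqs. mor_deg p q) =
     (- int (sum_list (map fst pqs)),
      int (length pqs) - int (sum_list (map fst pqs)) - int (sum_list (map snd pqs)))"
  by (induction pqs) (auto simp: mor_deg_def zero_prod_def)

text \<open>Koszul signs see only bidegrees and arities, never the maps. Here \<open>F\<close> and
  \<open>G\<close> may have different codomains, so a triple and its outer components carry the same
  sign.\<close>

lemma tensor_sign_factors_cong:
  "tensor_sign (factors \<delta> F pqs) xs = tensor_sign (factors \<delta> G pqs) xs"
  by (induction pqs arbitrary: xs) (auto simp: sum_deg_factors)

section \<open>Signs and bars inside multilinear maps\<close>

lemma multilinear_map_mem:
  "\<lbrakk>multilinear_map scA A scB B n \<delta> F; length xs = n; homog A xs\<rbrakk> \<Longrightarrow> F xs \<in> B (hdeg xs + \<delta>)"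
  by (simp add: multilinear_map_def)

lemma multilinear_map_uminus:
  assumes F: "multilinear_map scA A scB B n \<delta> F" and A: "bigraded_module scA A"
    and len: "length us + 1 + length vs = n" and hom: "homog A us" "homog A vs" "x \<in> A d"
  shows "F (us @ (d, - x) # vs) = - F (us @ (d, x) # vs)"
proof -
  interpret module scA using A by (simp add: bigraded_module_def)
  have sub: "subspace (A d)" using A unfolding bigraded_module_def by blast
  have add: "F (us @ (d, y + z) # vs) = F (us @ (d, y) # vs) + F (us @ (d, z) # vs)"
    if "y \<in> A d" "z \<in> A d" for y z
    using F len hom that by (cases d) (simp add: multilinear_map_def)
  have "F (us @ (d, 0) # vs) = 0"
    using add[of 0 0] subspace_0[OF sub] by simp
  then show ?thesis
    using add[OF hom(3) subspace_neg[OF sub hom(3)]] by (simp add: eq_neg_iff_add_eq_0 add.commute)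
qed

lemma multilinear_map_sgn_pow:
  assumes "multilinear_map scA A scB B n \<delta> F" "bigraded_module scA A"
    "length us + 1 + length vs = n" "homog A us" "homog A vs" "x \<in> A d"
  shows "F (us @ (d, sgn_pow e x) # vs) = sgn_pow e (F (us @ (d, x) # vs))"
  using multilinear_map_uminus[OF assms] by (simp add: sgn_pow_def)

lemma homog_map_path_bar:
  assumes "bigraded_module sc A" "homog A xs"
  shows "homog A (map (path_bar r) xs)"
proof -
  interpret module sc using assms by (simp add: bigraded_module_def)
  have "subspace (A d)" for d using assms(1) unfolding bigraded_module_def by blast
  then show ?thesis
    using assms(2) subspace_neg by (induction xs) (auto simp: path_bar_def sgn_pow_def)
qed

text \<open>The exponent of the bar is additive in the bidegree, so the signs of the single bars
  combine into one sign that depends only on the total bidegree of \<open>us\<close>.\<close>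

lemma multilinear_map_path_bar:
  assumes F: "multilinear_map scA A scB B n \<delta> F" and A: "bigraded_module scA A"
    and "length us + length vs = n" "homog A us" "homog A vs"
  shows "F (map (path_bar r) us @ vs) =
    sgn_pow (int r * fst (hdeg us) + (1 - int r) * snd (hdeg us)) (F (us @ vs))"
  using assms(3-)
\<comment> \<open>The last barred argument loses its bar and joins \<open>vs\<close>, so the barred
  arguments remain a prefix.\<close>
proof (induction us arbitrary: vs rule: rev_induct)
  case Nil
  then show ?case by (simp add: sgn_pow_def)
next
  case (snoc u us)
  obtain d x where u: "u = (d, x)" by fastforce
  have bar: "homog A (map (path_bar r) us)"
    using homog_map_path_bar[OF A] snoc.prems by simp
  have "F (map (path_bar r) (us @ [u]) @ vs) =
      sgn_pow (int r * fst d + (1 - int r) * snd d) (F (map (path_bar r) us @ (d, x) # vs))"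
    using multilinear_map_sgn_pow[OF F A _ bar, of vs x d] snoc.prems u by (simp add: path_bar_def)
  also have "\<dots> = sgn_pow (int r * fst d + (1 - int r) * snd d)
      (sgn_pow (int r * fst (hdeg us) + (1 - int r) * snd (hdeg us)) (F (us @ (d, x) # vs)))"
    using snoc.IH[of "(d, x) # vs"] snoc.prems u by simp
  finally show ?case
    using u by (simp add: algebra_simps)
qed

text \<open>Secures the domain condition for maps applied to a tensor of values:
  \<open>path_op\<close> and multilinear maps vanish off homogeneous inputs. The bound
  \<open>q \<ge> 1\<close> is what gives access to multilinearity in
  \<open>graded_family\<close>.\<close>

lemma homog_factors:
  assumes "graded_family scA A scB B \<delta> F" "\<forall>(p, q) \<in> set pqs. q \<ge> 1"
    "length xs = sum_list (map snd pqs)" "homog A xs"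
  shows "homog B (tensor_args (factors \<delta> F pqs) xs)"
  using assms(2-)
proof (induction pqs arbitrary: xs)
  case (Cons pq pqs)
  obtain p q where pq: "pq = (p, q)" by fastforce
  have "multilinear_map scA A scB B q (\<delta> p q) (F p q)"
    using assms(1) Cons.prems pq by (simp add: graded_family_def)
  then have "F p q (take q xs) \<in> B (hdeg (take q xs) + \<delta> p q)"
    using Cons.prems pq by (intro multilinear_map_mem homog_take) auto
  then show ?case
    using Cons pq by (simp add: homog_drop)
qed simp

section \<open>Maps into the path object as triples\<close>

definition triple ::
  "(nat \<Rightarrow> nat \<Rightarrow> 'a \<Rightarrow> 'b) \<Rightarrow> (nat \<Rightarrow> nat \<Rightarrow> 'a \<Rightarrow> 'b) \<Rightarrow> (nat \<Rightarrow> nat \<Rightarrow> 'a \<Rightarrow> 'b) \<Rightarrow>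
   nat \<Rightarrow> nat \<Rightarrow> 'a \<Rightarrow> 'b \<times> 'b \<times> 'b" where
  "triple f h g i k xs = (f i k xs, h i k xs, g i k xs)"

lemma htp_deg_eq: "htp_deg r i k = mor_deg i k + path_shift r"
  by (simp add: htp_deg_def mor_deg_def path_shift_def)

text \<open>Each degree of the path object is a product of three submodules with componentwise
  operations, so every condition splits. The shifted middle factor turns \<open>mor_deg\<close> into
  \<open>htp_deg r\<close>.\<close>

lemma multilinear_map_triple:
  "multilinear_map scA A (path_scale scB) (path_carrier r B) k (mor_deg i k) (triple f h g i k) \<longleftrightarrow>
     multilinear_map scA A scB B k (mor_deg i k) (f i k) \<and>
     multilinear_map scA A scB B k (htp_deg r i k) (h i k) \<and>
     multilinear_map scA A scB B k (mor_deg i k) (g i k)"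
  unfolding multilinear_map_def triple_def path_carrier_def path_scale_def htp_deg_eq
  by (simp add: zero_prod_def add.assoc imp_conjR all_conj_distrib)
    (rule iffI; elim conjE; intro conjI; assumption)

lemma graded_family_triple:
  "graded_family scA A (path_scale scB) (path_carrier r B) mor_deg (triple f h g) \<longleftrightarrow>
     graded_family scA A scB B mor_deg f \<and> graded_family scA A scB B (htp_deg r) h \<and>
     graded_family scA A scB B mor_deg g"
  unfolding graded_family_def multilinear_map_triple
  by (auto simp: triple_def zero_prod_def fun_eq_iff)

lemma comp_tensor_triple:
  "comp_tensor (triple f h g i j) \<phi>s xs =
     (comp_tensor (f i j) \<phi>s xs, comp_tensor (h i j) \<phi>s xs, comp_tensor (g i j) \<phi>s xs)"
  by (simp add: comp_tensor_def triple_def sgn_pow_triple)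

lemma path_xs_triple:
  "path_xs (tensor_args (factors \<delta> (triple f h g) pqs) xs) = tensor_args (factors \<delta> f pqs) xs"
  by (induction pqs arbitrary: xs) (auto simp: path_xs_def triple_def)

lemma path_zs_triple:
  "path_zs (tensor_args (factors \<delta> (triple f h g) pqs) xs) = tensor_args (factors \<delta> g pqs) xs"
  by (induction pqs arbitrary: xs) (auto simp: path_zs_def triple_def)

lemma path_ys_triple:
  "path_ys r (tensor_args (factors mor_deg (triple f h g) pqs) xs) =
     tensor_args (factors (htp_deg r) h pqs) xs"
  by (induction pqs arbitrary: xs) (auto simp: path_ys_def triple_def htp_deg_eq add.assoc)

section \<open>Structure maps of the path object on tensors of triples\<close>

lemma path_mid_triple:
  "path_mid r (tensor_args (factors mor_deg (triple f h g) (us @ pq # vs)) xs) (length us) =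
     map (path_bar r) (tensor_args (factors mor_deg f us) xs) @
     tensor_args (factors (htp_deg r) h [pq] @ factors mor_deg g vs)
       (drop (sum_list (map snd us)) xs)"
  unfolding path_mid_def path_xs_triple path_ys_triple path_zs_triple
  by (simp add: tensor_args_append nth_append)

text \<open>\<open>htp_factors\<close> with the position \<open>s\<close> replaced by the pieces
  before, at and after \<open>h\<close>, a form to which the append lemmas apply.\<close>

definition htp_split ::
  "nat \<Rightarrow> (nat \<Rightarrow> nat \<Rightarrow> 'a helt list \<Rightarrow> 'b) \<Rightarrow> (nat \<Rightarrow> nat \<Rightarrow> 'a helt list \<Rightarrow> 'b) \<Rightarrow>
   (nat \<Rightarrow> nat \<Rightarrow> 'a helt list \<Rightarrow> 'b) \<Rightarrow> (nat \<times> nat) list \<Rightarrow> nat \<times> nat \<Rightarrow> (nat \<times> nat) list \<Rightarrow>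
   ('a, 'b) gmap list" where
  "htp_split r f h g us pq vs =
     factors mor_deg f us @ factors (htp_deg r) h [pq] @ factors mor_deg g vs"

lemma htp_factors_eq:
  "s < length ps \<Longrightarrow> length ps = length qs \<Longrightarrow>
   htp_factors r f h g s ps qs =
     htp_split r f h g (take s (zip ps qs)) (zip ps qs ! s) (drop (s + 1) (zip ps qs))"
  by (simp add: htp_factors_def htp_split_def factors_def Let_def)

text \<open>Relative to a tensor product of morphism components, only the factor at
  \<open>pq\<close> changes bidegree, by \<open>path_shift r\<close>. The extra sign comes from
  moving this surplus past the inputs of \<open>us\<close>.\<close>

lemma tensor_sign_htp_split:
  "tensor_sign (htp_split r f h g us pq vs) xs =
     tensor_sign (factors mor_deg F (us @ pq # vs)) xs +
     bipair (path_shift r) (hdeg (take (sum_list (map snd us)) xs))"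
  unfolding htp_split_def
  by (simp add: tensor_sign_append sum_deg_factors htp_deg_eq bipair_add_left
      tensor_sign_factors_cong[of mor_deg F us _ f] tensor_sign_factors_cong[of mor_deg F vs _ g])

text \<open>
  Moving \<open>h\<close>, whose bidegree exceeds that of \<open>f\<close> and \<open>g\<close> by \<open>path_shift r\<close>, past the arguments of
  the factors \<open>f\<close> cancels the bars up to the bidegrees of these factors.
\<close>

lemma comp_tensor_path_mid:
  assumes mB: "multilinear_map scB B scB B (length (us @ pq # vs)) \<delta> M" and B: "bigraded_module scB B"
    and gr: "graded_family scA A scB B mor_deg f" "graded_family scA A scB B (htp_deg r) h"
      "graded_family scA A scB B mor_deg g"
    and q: "\<forall>(p, q) \<in> set (us @ pq # vs). q \<ge> 1"
    and xs: "length xs = sum_list (map snd (us @ pq # vs))" "homog A xs"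
  shows "sgn_pow (tensor_sign (factors mor_deg F (us @ pq # vs)) xs)
      (M (path_mid r (tensor_args (factors mor_deg (triple f h g) (us @ pq # vs)) xs) (length us))) =
    sgn_pow (int (sum_list (map fst us)) +
        (int r - 1) * (int (length us) + int (sum_list (map snd us))))
      (comp_tensor M (htp_split r f h g us pq vs) xs)"
proof -
  define n where "n = sum_list (map snd us)"
  define m where "m = sum_list (map fst us)"
  define d where "d = hdeg (take n xs)"
  let ?x = "tensor_args (factors mor_deg f us) xs"
  let ?yz = "tensor_args (factors (htp_deg r) h [pq] @ factors mor_deg g vs) (drop n xs)"
  have "homog B (tensor_args (factors mor_deg f us) (take n xs))"
    using xs q by (intro homog_factors[OF gr(1)] homog_take) (auto simp: n_def)
  \<comment> \<open>\<open>homog_factors\<close> requires an input list of exact length. The factors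
    of \<open>us\<close> read only the first \<open>n\<close> entries, so truncating
    \<open>xs\<close> leaves \<open>?x\<close> unchanged.\<close>
  moreover have "tensor_args (factors mor_deg f us) (take n xs) = ?x"
    unfolding n_def
  proof (induction us arbitrary: xs)
    case (Cons a us)
    then show ?case
      by (simp add: min_def take_drop[symmetric] drop_take)
  qed simp
  ultimately have hx: "homog B ?x" by simp
  have "homog B (tensor_args (factors (htp_deg r) h [pq]) (take (snd pq) (drop n xs)))"
    using xs q by (intro homog_factors[OF gr(2)] homog_take homog_drop) (auto simp: n_def)
  moreover have "homog B (tensor_args (factors mor_deg g vs) (drop (snd pq) (drop n xs)))"
    using xs q by (intro homog_factors[OF gr(3)] homog_drop) (auto simp: n_def)
  ultimately have hyz: "homog B ?yz"
    by (simp add: tensor_args_append)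
  have "M (map (path_bar r) ?x @ ?yz) =
      sgn_pow (int r * fst (hdeg ?x) + (1 - int r) * snd (hdeg ?x)) (M (?x @ ?yz))"
    by (rule multilinear_map_path_bar[OF mB B _ hx hyz]) simp
  moreover have "?x @ ?yz = tensor_args (htp_split r f h g us pq vs) xs"
    by (simp add: htp_split_def tensor_args_append n_def)
  moreover have "hdeg ?x = d + (- int m, int (length us) - int m - int n)"
    by (simp add: hdeg_tensor_args sum_deg_factors sum_mor_deg m_def n_def d_def)
  moreover have "tensor_sign (htp_split r f h g us pq vs) xs =
      tensor_sign (factors mor_deg F (us @ pq # vs)) xs + int r * fst d + (int r - 1) * snd d"
    unfolding tensor_sign_htp_split[where F = F]
    by (simp add: bipair_def path_shift_def d_def n_def)
  \<comment> \<open>Modulo 2 the contributions of \<open>d\<close> to the bars and to the Koszul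
    sign cancel. The remaining exponent -r m + (1 - r)(length us - m - n) has the parity of m + (r -
    1)(length us + n).\<close>
  ultimately show ?thesis
    unfolding path_mid_triple comp_tensor_def n_def[symmetric] m_def[symmetric]
    by (simp, intro sgn_pow_cong) (auto simp: algebra_simps)
qed

text \<open>The case \<open>j = 1\<close> obeys the general formula: the exponent r j + i + j
  becomes r + i + 1, which is odd for \<open>i = r\<close> and so yields the minus sign of
  \<open>M_{r1}\<close>. Only the term z - x remains exceptional.\<close>

lemma path_op_eq:
  assumes "j \<ge> 1" "length ws = j" "homog (path_carrier r B) ws"
  shows "path_op r B m i j ws =
    (m i j (path_xs ws),
     sgn_pow (int (r * j + i + j)) (\<Sum>k<j. m i j (path_mid r ws k)) +
       (if j = 1 \<and> i = r then snd (hd (path_zs ws)) - snd (hd (path_xs ws)) else 0),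
     m i j (path_zs ws))"
proof (cases "j = 1")
  case True
  then obtain w where w: "ws = [w]"
    using assms(2) by (cases ws) auto
  have "path_mid r ws 0 = path_ys r ws"
    by (simp add: w path_mid_def path_ys_def path_xs_def path_zs_def)
  then show ?thesis
    using assms True by (auto simp: path_op_def sgn_pow_def)
qed (use assms in \<open>simp add: path_op_def\<close>)

lemma sum_nth_shifted:
  assumes "s \<le> length ns"
  shows "(\<Sum>u = 1..s. int (ns ! (u - 1))) = int (sum_list (take s ns))"
  using assms by (induction s) (auto simp: take_Suc_conv_app_nth)

lemma map_fst_take_zip: "length ps = length qs \<Longrightarrow> map fst (take s (zip ps qs)) = take s ps"
  and map_snd_take_zip: "length ps = length qs \<Longrightarrow> map snd (take s (zip ps qs)) = take s qs"
  by (simp_all add: take_zip)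

text \<open>The sign left over in \<open>comp_tensor_path_mid\<close>, written with the 1-based sums
  of \<open>htp_alpha\<close> for later comparison.\<close>

definition htp_koszul :: "nat \<Rightarrow> nat \<Rightarrow> nat list \<Rightarrow> nat list \<Rightarrow> int" where
  "htp_koszul r s ps qs = (\<Sum>u = 1..s. int (ps ! (u - 1))) +
     (int r - 1) * (int s + (\<Sum>u = 1..s. int (qs ! (u - 1))))"

text \<open>Applies the preceding sign computation at each position \<open>s\<close> of
  \<open>h\<close>. The outer components follow from the projections commuting with tensor
  products.\<close>

lemma comp_tensor_path_op:
  assumes mB: "graded_family scB B scB B alg_deg mB" and B: "bigraded_module scB B"
    and gr: "graded_family scA A scB B mor_deg f" "graded_family scA A scB B (htp_deg r) h"
      "graded_family scA A scB B mor_deg g"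
    and idx: "(ps, qs) \<in> block_indices p k" and k: "k \<ge> 1"
    and xs: "length xs = k" "homog A xs"
  shows "comp_tensor (path_op r B mB i (length qs))
      (factors mor_deg (triple f h g) (zip ps qs)) xs =
    (comp_tensor (mB i (length qs)) (factors mor_deg f (zip ps qs)) xs,
     sgn_pow (int (r * length qs + i + length qs)) (\<Sum>s<length qs.
         sgn_pow (htp_koszul r s ps qs)
           (comp_tensor (mB i (length qs)) (htp_factors r f h g s ps qs) xs)) +
       (if length qs = 1 \<and> i = r then g p k xs - f p k xs else 0),
     comp_tensor (mB i (length qs)) (factors mor_deg g (zip ps qs)) xs)"
proof -
  let ?l = "length qs"
  let ?F = "factors mor_deg (triple f h g) (zip ps qs)"
  let ?ws = "tensor_args ?F xs"
  let ?e = "tensor_sign ?F xs"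
  have len: "length ps = ?l" and pos: "\<forall>q\<in>set qs. q \<ge> 1" and sum: "sum_list ps = p" "sum_list qs = k"
    using idx by (auto simp: block_indices_def)
  have l: "?l \<ge> 1"
    using sum(2) k by (cases qs) auto
  have "homog (path_carrier r B) ?ws"
    using gr len pos sum xs
    by (intro homog_factors[of scA A "path_scale scB" _ mor_deg])
      (auto simp: graded_family_triple dest: set_zip_rightD)
  then have op: "path_op r B mB i ?l ?ws =
    (mB i ?l (path_xs ?ws),
     sgn_pow (int (r * ?l + i + ?l)) (\<Sum>s<?l. mB i ?l (path_mid r ?ws s)) +
       (if ?l = 1 \<and> i = r then snd (hd (path_zs ?ws)) - snd (hd (path_xs ?ws)) else 0),
     mB i ?l (path_zs ?ws))"
    using l len by (intro path_op_eq) auto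
  have mid: "sgn_pow ?e (mB i ?l (path_mid r ?ws s)) =
      sgn_pow (htp_koszul r s ps qs) (comp_tensor (mB i ?l) (htp_factors r f h g s ps qs) xs)"
    if s: "s < ?l" for s
  proof -
    define us pq vs where "us = take s (zip ps qs)" and "pq = zip ps qs ! s"
      and "vs = drop (s + 1) (zip ps qs)"
    have split: "zip ps qs = us @ pq # vs"
      using id_take_nth_drop[of s "zip ps qs"] s len
      unfolding us_def pq_def vs_def by (metis Suc_eq_plus1 length_zip min.idem)
    have lus: "length us = s"
      using s len by (simp add: us_def)
    have "length (us @ pq # vs) = ?l"
      using len split by (metis length_zip min.idem)
    moreover have "sum_list (map snd (us @ pq # vs)) = k"
      unfolding split[symmetric] using len sum by simp
    moreover have "\<forall>(p, q)\<in>set (us @ pq # vs). q \<ge> 1"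
      unfolding split[symmetric] using pos by (auto dest: set_zip_rightD)
    moreover have "multilinear_map scB B scB B ?l (alg_deg i ?l) (mB i ?l)"
      using mB l by (simp add: graded_family_def)
    moreover have "htp_koszul r s ps qs =
        int (sum_list (map fst us)) + (int r - 1) * (int (length us) + int (sum_list (map snd us)))"
      using s len lus
      by (simp add: htp_koszul_def sum_nth_shifted us_def map_fst_take_zip map_snd_take_zip
          del: One_nat_def)
    moreover have "htp_factors r f h g s ps qs = htp_split r f h g us pq vs"
      unfolding us_def pq_def vs_def using s len by (simp only: htp_factors_eq)
    ultimately show ?thesis
      using comp_tensor_path_mid[OF _ B gr, of us pq vs _ "mB i ?l" xs "triple f h g"] xs lus
      by (simp add: split)
  qed
  \<comment> \<open>A single block must be \<open>([p], [k])\<close>, and one factor alone has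
    Koszul exponent 0.\<close>
  have unit: "sgn_pow ?e (snd (hd (path_zs ?ws)) - snd (hd (path_xs ?ws))) = g p k xs - f p k xs"
    if "?l = 1"
  proof -
    have "ps = [p]" "qs = [k]"
      using that len sum by (auto simp: length_Suc_conv)
    then show ?thesis
      using xs by (simp add: path_xs_def path_zs_def triple_def sgn_pow_def)
  qed
  have "sgn_pow ?e (\<Sum>s<?l. mB i ?l (path_mid r ?ws s)) = (\<Sum>s<?l.
      sgn_pow (htp_koszul r s ps qs) (comp_tensor (mB i ?l) (htp_factors r f h g s ps qs) xs))"
    unfolding sgn_pow_sum using mid by (intro sum.cong) auto
  then have middle: "sgn_pow ?e (sgn_pow N (\<Sum>s<?l. mB i ?l (path_mid r ?ws s))) =
      sgn_pow N (\<Sum>s<?l. sgn_pow (htp_koszul r s ps qs)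
        (comp_tensor (mB i ?l) (htp_factors r f h g s ps qs) xs))" for N
    by (subst sgn_pow_commute) (simp only:)
  have fst: "sgn_pow ?e (mB i ?l (path_xs ?ws)) =
      comp_tensor (mB i ?l) (factors mor_deg f (zip ps qs)) xs"
    by (simp only: comp_tensor_def path_xs_triple
        tensor_sign_factors_cong[of mor_deg "triple f h g" _ _ f])
  have snd: "sgn_pow ?e (mB i ?l (path_zs ?ws)) =
      comp_tensor (mB i ?l) (factors mor_deg g (zip ps qs)) xs"
    by (simp only: comp_tensor_def path_zs_triple
        tensor_sign_factors_cong[of mor_deg "triple f h g" _ _ g])
  show ?thesis
    unfolding comp_tensor_def[of "path_op r B mB i ?l"] op sgn_pow_triple sgn_pow_add middle fst snd
    using unit by simp
qed

section \<open>Finiteness and reindexing of the sums\<close>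

lemma finite_block_indices: "finite (block_indices p k)"
proof -
  \<comment> \<open>All entries of \<open>qs\<close> are positive, so \<open>k\<close> bounds the
    common length of the two lists.\<close>
  have le: "length qs \<le> sum_list qs" if "\<forall>q\<in>set qs. q \<ge> 1" for qs :: "nat list"
    using that by (induction qs) auto
  have mem: "set ns \<subseteq> {..sum_list ns}" for ns :: "nat list"
    using member_le_sum_list by fastforce
  have "block_indices p k \<subseteq>
      {ps. set ps \<subseteq> {..p} \<and> length ps \<le> k} \<times> {qs. set qs \<subseteq> {..k} \<and> length qs \<le> k}"
    using le mem by (fastforce simp: block_indices_def)
  then show ?thesis
    by (rule finite_subset) (intro finite_cartesian_product finite_lists_length_le finite_atMost)
qed

lemma finite_insert_slots: "finite {(l, q, s, t). q \<ge> 1 \<and> q + s + t = k \<and> s + 1 + t = (l::nat)}"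
  by (rule finite_subset[of _ "{..k+1} \<times> {..k} \<times> {..k} \<times> {..k}"]) auto

text \<open>\<open>p\<close> is determined by \<open>i\<close>, and the arity condition k + 1 = j +
  q with j = 1 + s + t amounts to q + s + t = k.\<close>

lemma sum_insert_indices:
  "(\<Sum>(i, j, p, q, s, t) \<in> insert_indices u k. F i j p q s t) =
   (\<Sum>i\<le>u. \<Sum>(l, q, s, t) \<in> {(l, q, s, t). q \<ge> 1 \<and> q + s + t = k \<and> s + 1 + t = l}.
      F i l (u - i) q s t)"
  unfolding sum.Sigma[OF finite_atMost ballI[OF finite_insert_slots]]
  by (rule sum.reindex_bij_witness
      [where i = "\<lambda>(i, l, q, s, t). (i, l, u - i, q, s, t)"
        and j = "\<lambda>(i, l, p, q, s, t). (i, l, q, s, t)"])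
    (auto simp: insert_indices_def)

lemma sum_antidiagonal:
  "(\<Sum>(i, p) \<in> {(i, p). i + p = m}. F i p) = (\<Sum>i\<le>(m::nat). F i (m - i))"
  by (rule sum.reindex_bij_witness[where i = "\<lambda>i. (i, m - i)" and j = fst]) auto

text \<open>Even, so the terms with one block carry only the sign (-1)^u.\<close>

lemma block_sign_singleton: "block_sign [p] [q] = 2 * (p + q)"
  by (simp add: block_sign_def)

text \<open>For each \<open>p\<close> the only index with one block is \<open>([p], [k])\<close>,
  and \<open>i = r\<close> fixes \<open>p = u - r\<close>. Hence at most one term survives, and none
  if \<open>u < r\<close>.\<close>

lemma sum_block_unit:
  assumes "k \<ge> 1"
  shows "(\<Sum>i\<le>u. \<Sum>(ps, qs) \<in> block_indices (u - i) k.
       if length qs = 1 \<and> i = r then sgn_pow (int (u + block_sign ps qs)) (x (u - i)) else 0) =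
     (if u < r then 0 else sgn_pow (int u) (x (u - r)))"
proof -
  have "(\<Sum>(ps, qs) \<in> block_indices p k.
       if length qs = 1 then sgn_pow (int (u + block_sign ps qs)) y else 0) = sgn_pow (int u) y"
    for p and y :: 'a
  proof -
    have "(\<Sum>(ps, qs) \<in> block_indices p k.
        if length qs = 1 then sgn_pow (int (u + block_sign ps qs)) y else 0) =
      (\<Sum>(ps, qs) \<in> {([p], [k])}.
        if length qs = 1 then sgn_pow (int (u + block_sign ps qs)) y else 0)"
      using assms
      by (intro sum.mono_neutral_right finite_block_indices)
        (auto simp: block_indices_def length_Suc_conv split: if_splits)
    then show ?thesis
      by (simp add: block_sign_singleton, intro sgn_pow_cong) simp
  qed
  then have "(\<Sum>i\<le>u. \<Sum>(ps, qs) \<in> block_indices (u - i) k.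
       if length qs = 1 \<and> i = r then sgn_pow (int (u + block_sign ps qs)) (x (u - i)) else 0) =
     (\<Sum>i\<le>u. if i = r then sgn_pow (int u) (x (u - i)) else 0)"
    by (intro sum.cong refl) auto
  then show ?thesis
    by (simp add: not_less)
qed

section \<open>The morphism equation by components\<close>

abbreviation morphism_lhs where
  "morphism_lhs mA f u k xs \<equiv> \<Sum>(i, j, p, q, s, t) \<in> insert_indices u k.
     sgn_pow (int (s * q + t + p * j)) (comp_tensor (f i j) (insert_op mA s p q t) xs)"

text \<open>Both sides are abbreviations, so that they agree literally with the unfolded
  \<open>dA_morphism_def\<close>. The left side does not mention the bidegree of its family and
  therefore makes sense for \<open>h\<close> as well.\<close>

abbreviation morphism_rhs where
  "morphism_rhs mB f u k xs \<equiv> \<Sum>i\<le>u. \<Sum>(ps, qs) \<in> block_indices (u - i) k.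
     sgn_pow (int (u + block_sign ps qs))
       (comp_tensor (mB i (length qs)) (map (\<lambda>(p, q). (mor_deg p q, q, f p q)) (zip ps qs)) xs)"

text \<open>The middle component of the right side without the z - x terms. Its sign combines u +
  \<open>block_sign\<close> from the morphism equation, r l + i + l from \<open>path_op\<close>,
  where l is \<open>length qs\<close>, and \<open>htp_koszul\<close>.\<close>

definition htp_rhs where
  "htp_rhs r mB f h g u k xs = (\<Sum>i\<le>u. \<Sum>(ps, qs) \<in> block_indices (u - i) k.
     \<Sum>s<length qs. sgn_pow (int (u + block_sign ps qs + r * length qs + i + length qs) +
         htp_koszul r s ps qs)
       (comp_tensor (mB i (length qs)) (htp_factors r f h g s ps qs) xs))"

text \<open>The inserted operation acts inside A, so the triple is only the outermost map and the
  sum is componentwise.\<close>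

lemma morphism_lhs_triple:
  "morphism_lhs mA (triple f h g) u k xs =
     (morphism_lhs mA f u k xs, morphism_lhs mA h u k xs, morphism_lhs mA g u k xs)"
  by (simp add: comp_tensor_triple sgn_pow_triple split_def sum_triple)

lemma morphism_rhs_triple:
  assumes "graded_family scB B scB B alg_deg mB" "bigraded_module scB B"
    and "graded_family scA A scB B mor_deg f" "graded_family scA A scB B (htp_deg r) h"
      "graded_family scA A scB B mor_deg g"
    and "k \<ge> 1" and "length xs = k" "homog A xs"
  shows "morphism_rhs (path_op r B mB) (triple f h g) u k xs =
     (morphism_rhs mB f u k xs,
      htp_rhs r mB f h g u k xs +
        (if u < r then 0 else sgn_pow (int u) (g (u - r) k xs - f (u - r) k xs)),
      morphism_rhs mB g u k xs)"
proof -
  have "morphism_rhs (path_op r B mB) (triple f h g) u k xs =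
      (\<Sum>i\<le>u. \<Sum>(ps, qs) \<in> block_indices (u - i) k.
        (sgn_pow (int (u + block_sign ps qs))
           (comp_tensor (mB i (length qs)) (factors mor_deg f (zip ps qs)) xs),
         (\<Sum>s<length qs. sgn_pow (int (u + block_sign ps qs + r * length qs + i + length qs) +
             htp_koszul r s ps qs)
           (comp_tensor (mB i (length qs)) (htp_factors r f h g s ps qs) xs)) +
         (if length qs = 1 \<and> i = r then
            sgn_pow (int (u + block_sign ps qs)) (g (u - i) k xs - f (u - i) k xs) else 0),
         sgn_pow (int (u + block_sign ps qs))
           (comp_tensor (mB i (length qs)) (factors mor_deg g (zip ps qs)) xs)))"
    unfolding factors_def[symmetric]
  proof (intro sum.cong refl, clarify)
    fix i ps qs
    assume "(ps, qs) \<in> block_indices (u - i) k"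
    from comp_tensor_path_op[OF assms(1-5) this assms(6-8), of i]
    show "sgn_pow (int (u + block_sign ps qs)) (comp_tensor (path_op r B mB i (length qs))
        (factors mor_deg (triple f h g) (zip ps qs)) xs) =
      (sgn_pow (int (u + block_sign ps qs))
           (comp_tensor (mB i (length qs)) (factors mor_deg f (zip ps qs)) xs),
         (\<Sum>s<length qs. sgn_pow (int (u + block_sign ps qs + r * length qs + i + length qs) +
             htp_koszul r s ps qs)
           (comp_tensor (mB i (length qs)) (htp_factors r f h g s ps qs) xs)) +
         (if length qs = 1 \<and> i = r then
            sgn_pow (int (u + block_sign ps qs)) (g (u - i) k xs - f (u - i) k xs) else 0),
         sgn_pow (int (u + block_sign ps qs))
           (comp_tensor (mB i (length qs)) (factors mor_deg g (zip ps qs)) xs))"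
      by (simp add: sgn_pow_triple sgn_pow_add sgn_pow_sum add.assoc)
  qed
  \<comment> \<open>The collapsed unit term is expanded back into a sum over all blocks, so that
    \<open>sum.distrib\<close> splits it off from \<open>htp_rhs\<close>.\<close>
  then show ?thesis
    unfolding sum_block_unit[OF assms(6), where u = u and r = r and
        x = "\<lambda>p. g p k xs - f p k xs", symmetric]
    by (simp add: split_def sum_triple sum.distrib htp_rhs_def factors_def)
qed

lemma htp_equation_iff:
  "htp_equation r mA mB f g h m k xs \<longleftrightarrow>
     morphism_lhs mA h m k xs = htp_rhs r mB f h g m k xs +
       (if m < r then 0 else sgn_pow (int m) (g (m - r) k xs - f (m - r) k xs))"
proof -
  define D where "D = (if m < r then 0 else g (m - r) k xs - f (m - r) k xs)"
  \<comment> \<open>Modulo 2, (r - 1)(l + 1) equals r l + l + r + 1 and m - i equals m + i, where l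
    is \<open>length qs\<close>. The two exponents thus differ by r + 1.\<close>
  have rhs: "(\<Sum>i\<le>m. \<Sum>(ps, qs) \<in> block_indices (m - i) k. \<Sum>s<length qs.
      sgn_pow (int (m - i) + htp_alpha r s ps qs + (\<Sum>u = 1..s. int (ps ! (u - 1))))
        (comp_tensor (mB i (length qs)) (htp_factors r f h g s ps qs) xs)) =
    sgn_pow (int r + 1) (htp_rhs r mB f h g m k xs)"
    unfolding htp_rhs_def sgn_pow_sum split_def sgn_pow_sgn_pow
    by (intro sum.cong refl sgn_pow_cong)
      (simp add: htp_alpha_def htp_koszul_def of_nat_diff algebra_simps del: One_nat_def)
  have lhs: "(\<Sum>i\<le>m. \<Sum>(l, q, s, t) \<in> {(l, q, s, t). q \<ge> 1 \<and> q + s + t = k \<and> s + 1 + t = l}.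
      sgn_pow (htp_beta r (m - i) q s t l) (comp_tensor (h i l) (insert_op mA s (m - i) q t) xs)) =
    sgn_pow (int r) (morphism_lhs mA h m k xs)"
    unfolding sum_insert_indices unfolding sgn_pow_sum split_def sgn_pow_sgn_pow
    by (intro sum.cong refl sgn_pow_cong) (simp add: htp_beta_def)
  have "htp_equation r mA mB f g h m k xs \<longleftrightarrow>
      sgn_pow (int m - int r) (sgn_pow (int r + 1) (htp_rhs r mB f h g m k xs) +
        sgn_pow (int r) (morphism_lhs mA h m k xs)) = D"
    unfolding htp_equation_def sum_antidiagonal sum.distrib D_def lhs rhs[symmetric]
    by (simp add: lessThan_def)
  \<comment> \<open>The factors (-1)^r cancel, leaving (-1)^m times the difference of the two sides
    equal to \<open>D\<close>.\<close>
  also have "\<dots> \<longleftrightarrow> morphism_lhs mA h m k xs = htp_rhs r mB f h g m k xs + sgn_pow (int m) D"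
    by (auto simp: sgn_pow_def algebra_simps eq_neg_iff_add_eq_0)
  finally show ?thesis
    unfolding D_def by (simp add: if_distrib)
qed

section \<open>The correspondence between path morphisms and homotopy families\<close>

lemma dA_morphism_triple:
  assumes B: "dA_algebra scB B mB"
    and f: "dA_morphism scA A mA scB B mB f" and g: "dA_morphism scA A mA scB B mB g"
  shows "dA_morphism scA A mA (path_scale scB) (path_carrier r B) (path_op r B mB) (triple f h g)
    \<longleftrightarrow> htp_family r scA A mA scB B mB f g h"
proof -
  have gr: "graded_family scA A scB B mor_deg f" "graded_family scA A scB B mor_deg g"
    using f g unfolding dA_morphism_def by blast+
  have iff: "morphism_lhs mA (triple f h g) u k xs =
        morphism_rhs (path_op r B mB) (triple f h g) u k xs
      \<longleftrightarrow> htp_equation r mA mB f g h u k xs"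
    if h: "graded_family scA A scB B (htp_deg r) h" and k: "k \<ge> 1" "length xs = k" "homog A xs"
    for u k xs
  proof -
    have mB: "graded_family scB B scB B alg_deg mB" "bigraded_module scB B"
      using B unfolding dA_algebra_def by blast+
    have "morphism_lhs mA f u k xs = morphism_rhs mB f u k xs"
      "morphism_lhs mA g u k xs = morphism_rhs mB g u k xs"
      using f g k unfolding dA_morphism_def by blast+
    then show ?thesis
      unfolding morphism_lhs_triple htp_equation_iff
        morphism_rhs_triple[OF mB gr(1) h gr(2) k] prod.inject by (simp only: simp_thms)
  qed
  show ?thesis
  \<comment> \<open>The equations are comparable only for a graded family \<open>h\<close>;
    otherwise both sides of the equivalence are false.\<close>
  proof (cases "graded_family scA A scB B (htp_deg r) h")
    case True
    have "(\<forall>u. \<forall>k\<ge>1. \<forall>xs. length xs = k \<and> homog A xs \<longrightarrow>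
        morphism_lhs mA (triple f h g) u k xs =
        morphism_rhs (path_op r B mB) (triple f h g) u k xs) \<longleftrightarrow>
      (\<forall>m. \<forall>k\<ge>1. \<forall>xs. length xs = k \<and> homog A xs \<longrightarrow> htp_equation r mA mB f g h m k xs)"
      by (intro all_cong1 imp_cong refl; elim conjE; rule iff[OF True]; assumption)
    with True gr show ?thesis
      unfolding dA_morphism_def htp_family_def graded_family_triple by (simp only: simp_thms)
  next
    case False
    then show ?thesis
      unfolding dA_morphism_def htp_family_def graded_family_triple by blast
  qed
qed

theorem proposition5p32:
  fixes r :: nat
    and scA :: "'r::comm_ring_1 \<Rightarrow> 'a::ab_group_add \<Rightarrow> 'a"
    and A :: "bideg \<Rightarrow> 'a set"
    and mA :: "nat \<Rightarrow> nat \<Rightarrow> 'a helt list \<Rightarrow> 'a"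
    and scB :: "'r \<Rightarrow> 'b::ab_group_add \<Rightarrow> 'b"
    and B :: "bideg \<Rightarrow> 'b set"
    and mB :: "nat \<Rightarrow> nat \<Rightarrow> 'b helt list \<Rightarrow> 'b"
    and f g :: "nat \<Rightarrow> nat \<Rightarrow> 'a helt list \<Rightarrow> 'b"
  assumes "dA_algebra scA A mA" and "dA_algebra scB B mB"
    and "dA_morphism scA A mA scB B mB f" and "dA_morphism scA A mA scB B mB g"
  shows "bij_betw (\<lambda>h i k. path_middle \<circ> h i k)
           {h. r_homotopy r scA A mA scB B mB f g h}
           {h. htp_family r scA A mA scB B mB f g h}"
proof -
  have mid: "(\<lambda>i k. path_middle \<circ> triple f h g i k) = h" for h
    by (auto simp: fun_eq_iff triple_def path_middle_def)
  \<comment> \<open>The boundary conditions prescribe the outer components, so a homotopy is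
    determined by its middle one. This makes \<open>h \<mapsto> triple f h g\<close> the inverse
    map.\<close>
  have "H = triple f (\<lambda>i k. path_middle \<circ> H i k) g"
    if "r_homotopy r scA A mA scB B mB f g H" for H
    using that
    by (auto simp: r_homotopy_def triple_def path_middle_def path_minus_def path_plus_def
        fun_eq_iff split_beta prod_eq_iff)
  moreover have "r_homotopy r scA A mA scB B mB f g (triple f h g) \<longleftrightarrow>
      htp_family r scA A mA scB B mB f g h" for h
    using dA_morphism_triple[OF assms(2-4), of r h]
    by (auto simp: r_homotopy_def triple_def path_minus_def path_plus_def fun_eq_iff)
  ultimately show ?thesis
    using mid by (intro bij_betw_byWitness[where f' = "\<lambda>h. triple f h g"]) (auto, metis)
qed

end
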